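(* For a fixed Coxeter element $C$, the form $\langle\cdot,\cdot\rangle^\Pi$ on $Q(R)$ does not depend on the choice of the simple root system $\Pi$ compatible with $C$.
   Context: $R\subset E$ is a reduced, irreducible, simply-laced root system (type $A,D,E$) of rank $r$ in a Euclidean space $E$ with $W$-invariant inner product $(\cdot,\cdot)$ normalized so that $(\alpha,\alpha)=2$ for $\alpha\in R$; $W$ is its Weyl group, $Q(R)$ its root lattice. A simple root system $\Pi\subset R$ is a base of $R$. There is a fixed index set $I$ and, for each simple root system $\Pi$, a bijection $I\to\Pi$, $i\mapsto\alpha_i^\Pi$, such that $w(\alpha_i^\Pi)=\alpha_i^{w(\Pi)}$ for all $w\in W$. For $i\ne j$ put $n_{ij}=-(\alpha_i^\Pi,\alpha_j^\Pi)\in\{0,1\}$ (independent of $\Pi$); $I$ also denotes the Dynkin diagram, the graph with vertex set $I$ and $n_{ij}$ edges between $i$ and $j$. Let $s_i^\Pi$ be the reflection in $\alpha_i^\Pi$. A Coxeter element is a product, in some order, of all the simple reflections of some simple root system, each taken once. $\Pi$ is compatible with $C$ if $C=s^\Pi_{i_1}\cdots s^\Pi_{i_r}$ for some enumeration $i_1,\dots,i_r$ of $I$. For compatible $\Pi$, the orientation $\Omega_\Pi$ of $I$ is: for $n_{ij}=1$, $i\to j$ if $s_i^\Pi$ precedes $s_j^\Pi$ in such an expression for $C$ (independent of the expression). Write $i\leqslant j$ if there is an oriented path (possibly of length $0$) from $i$ to $j$ in $\Omega_\Pi$, and set $\beta_i^\Pi=\sum_{j\leqslant i}\alpha_j^\Pi$;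 the $\beta_i^\Pi$ form a basis of $Q(R)$. For $\Pi$ compatible with $C$, $\langle\cdot,\cdot\rangle^\Pi$ is the bilinear form on $Q(R)$ determined by $\langle\beta_i^\Pi,\alpha_j^\Pi\rangle^\Pi=\delta_{ij}$ for all $i,j\in I$. *)

theory Defs
  imports "HOL-Analysis.Analysis"
begin

section \<open>Simply-laced root systems\<close>

definition refl_at :: "'a::euclidean_space \<Rightarrow> 'a \<Rightarrow> 'a" where
  "refl_at a x = x - (2 * (x \<bullet> a) / (a \<bullet> a)) *\<^sub>R a"

definition root_system :: "'a::euclidean_space set \<Rightarrow> bool" where
  "root_system R \<longleftrightarrow>
     finite R \<and> 0 \<notin> R \<and> span R = UNIV \<and>
     (\<forall>a\<in>R. refl_at a ` R = R) \<and>
     (\<forall>a\<in>R. \<forall>b\<in>R. 2 * (b \<bullet> a) / (a \<bullet> a) \<in> \<int>)"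

definition reduced_roots :: "'a::euclidean_space set \<Rightarrow> bool" where
  "reduced_roots R \<longleftrightarrow> (\<forall>a\<in>R. \<forall>c::real. c *\<^sub>R a \<in> R \<longrightarrow> c = 1 \<or> c = -1)"

definition irreducible_roots :: "'a::euclidean_space set \<Rightarrow> bool" where
  "irreducible_roots R \<longleftrightarrow> R \<noteq> {} \<and>
     \<not> (\<exists>A B. A \<noteq> {} \<and> B \<noteq> {} \<and> A \<union> B = R \<and> A \<inter> B = {} \<and> (\<forall>a\<in>A. \<forall>b\<in>B. a \<bullet> b = 0))"

text \<open>Simply-laced means that all roots have the same length; the inner product of the ambient
  space is the one normalized so that this squared length is 2.\<close>

definition simply_laced_root_system :: "'a::euclidean_space set \<Rightarrow> bool" where
  "simply_laced_root_system R \<longleftrightarrow>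
     root_system R \<and> reduced_roots R \<and> irreducible_roots R \<and> (\<forall>a\<in>R. a \<bullet> a = 2)"

inductive_set weyl_group :: "'a::euclidean_space set \<Rightarrow> ('a \<Rightarrow> 'a) set" for R where
  weyl_id: "id \<in> weyl_group R"
| weyl_refl: "a \<in> R \<Longrightarrow> w \<in> weyl_group R \<Longrightarrow> refl_at a \<circ> w \<in> weyl_group R"

definition root_lattice :: "'a::euclidean_space set \<Rightarrow> 'a set" where
  "root_lattice R = {\<Sum>a\<in>R. of_int (c a) *\<^sub>R a | c :: 'a \<Rightarrow> int. True}"

definition simple_roots :: "'a::euclidean_space set \<Rightarrow> 'a set \<Rightarrow> bool" where
  "simple_roots R S \<longleftrightarrow> S \<subseteq> R \<and> independent S \<and>
     (\<forall>b\<in>R. \<exists>c :: 'a \<Rightarrow> nat. b = (\<Sum>a\<in>S. of_nat (c a) *\<^sub>R a) \<or> b = - (\<Sum>a\<in>S. of_nat (c a) *\<^sub>R a))"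


section \<open>Coxeter elements and compatible simple root systems\<close>

text \<open>\<open>\<alpha> S i\<close> is the simple root of the simple root system \<open>S\<close> labelled by \<open>i \<in> I\<close>; the labellings
  of the various \<open>S\<close> are matched up by the Weyl group.\<close>

definition simple_root_labelling ::
  "'a::euclidean_space set \<Rightarrow> 'i set \<Rightarrow> ('a set \<Rightarrow> 'i \<Rightarrow> 'a) \<Rightarrow> bool" where
  "simple_root_labelling R I \<alpha> \<longleftrightarrow>
     (\<forall>S. simple_roots R S \<longrightarrow> bij_betw (\<alpha> S) I S) \<and>
     (\<forall>S w. \<forall>i\<in>I. simple_roots R S \<longrightarrow> w \<in> weyl_group R \<longrightarrow> w (\<alpha> S i) = \<alpha> (w ` S) i)"

text \<open>\<open>refl_prod [a\<^sub>1, \<dots>, a\<^sub>k]\<close> is \<open>s\<^sub>1 \<circ> \<dots> \<circ> s\<^sub>k\<close>, so the last reflection acts first.\<close>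

definition refl_prod :: "'a::euclidean_space list \<Rightarrow> 'a \<Rightarrow> 'a" where
  "refl_prod as = foldr (\<lambda>a f. refl_at a \<circ> f) as id"

definition coxeter_element :: "'a::euclidean_space set \<Rightarrow> ('a \<Rightarrow> 'a) \<Rightarrow> bool" where
  "coxeter_element R C \<longleftrightarrow>
     (\<exists>S as. simple_roots R S \<and> distinct as \<and> set as = S \<and> C = refl_prod as)"

definition coxeter_word ::
  "'i set \<Rightarrow> ('a set \<Rightarrow> 'i \<Rightarrow> 'a::euclidean_space) \<Rightarrow> ('a \<Rightarrow> 'a) \<Rightarrow> 'a set \<Rightarrow> 'i list \<Rightarrow> bool" where
  "coxeter_word I \<alpha> C S is \<longleftrightarrow> distinct is \<and> set is = I \<and> C = refl_prod (map (\<alpha> S) is)"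

definition compatible ::
  "'a::euclidean_space set \<Rightarrow> 'i set \<Rightarrow> ('a set \<Rightarrow> 'i \<Rightarrow> 'a) \<Rightarrow> ('a \<Rightarrow> 'a) \<Rightarrow> 'a set \<Rightarrow> bool" where
  "compatible R I \<alpha> C S \<longleftrightarrow> simple_roots R S \<and> (\<exists>is. coxeter_word I \<alpha> C S is)"

definition dynkin_n :: "('a set \<Rightarrow> 'i \<Rightarrow> 'a::euclidean_space) \<Rightarrow> 'a set \<Rightarrow> 'i \<Rightarrow> 'i \<Rightarrow> real" where
  "dynkin_n \<alpha> S i j = - (\<alpha> S i \<bullet> \<alpha> S j)"

text \<open>Since the relative order of two adjacent vertices is the same in all expressions for \<open>C\<close>,
  it is enough to ask for one expression in which \<open>i\<close> precedes \<open>j\<close>.\<close>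

definition orientation_arrow ::
  "'i set \<Rightarrow> ('a set \<Rightarrow> 'i \<Rightarrow> 'a::euclidean_space) \<Rightarrow> ('a \<Rightarrow> 'a) \<Rightarrow> 'a set \<Rightarrow> 'i \<Rightarrow> 'i \<Rightarrow> bool" where
  "orientation_arrow I \<alpha> C S i j \<longleftrightarrow>
     i \<in> I \<and> j \<in> I \<and> i \<noteq> j \<and> dynkin_n \<alpha> S i j = 1 \<and>
     (\<exists>is k l. coxeter_word I \<alpha> C S is \<and> k < l \<and> l < length is \<and> is ! k = i \<and> is ! l = j)"

definition orientation_le ::
  "'i set \<Rightarrow> ('a set \<Rightarrow> 'i \<Rightarrow> 'a::euclidean_space) \<Rightarrow> ('a \<Rightarrow> 'a) \<Rightarrow> 'a set \<Rightarrow> 'i \<Rightarrow> 'i \<Rightarrow> bool" where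
  "orientation_le I \<alpha> C S = (orientation_arrow I \<alpha> C S)\<^sup>*\<^sup>*"

definition beta ::
  "'i set \<Rightarrow> ('a set \<Rightarrow> 'i \<Rightarrow> 'a::euclidean_space) \<Rightarrow> ('a \<Rightarrow> 'a) \<Rightarrow> 'a set \<Rightarrow> 'i \<Rightarrow> 'a" where
  "beta I \<alpha> C S i = (\<Sum>j\<in>{j\<in>I. orientation_le I \<alpha> C S j i}. \<alpha> S j)"


section \<open>The bilinear form\<close>

definition bilinear_form_on :: "'a::ab_group_add set \<Rightarrow> ('a \<Rightarrow> 'a \<Rightarrow> int) \<Rightarrow> bool" where
  "bilinear_form_on Q f \<longleftrightarrow>
     (\<forall>x\<in>Q. \<forall>y\<in>Q. \<forall>z\<in>Q. f (x + y) z = f x z + f y z \<and> f x (y + z) = f x y + f x z)"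

text \<open>A form on the root lattice is represented by a function on the whole space that is 0 off the
  lattice; this makes the function unique.\<close>

definition coxeter_form ::
  "'a::euclidean_space set \<Rightarrow> 'i set \<Rightarrow> ('a set \<Rightarrow> 'i \<Rightarrow> 'a) \<Rightarrow> ('a \<Rightarrow> 'a) \<Rightarrow> 'a set \<Rightarrow> 'a \<Rightarrow> 'a \<Rightarrow> int" where
  "coxeter_form R I \<alpha> C S = (THE f.
     bilinear_form_on (root_lattice R) f \<and>
     (\<forall>x y. x \<notin> root_lattice R \<or> y \<notin> root_lattice R \<longrightarrow> f x y = 0) \<and>
     (\<forall>i\<in>I. \<forall>j\<in>I. f (beta I \<alpha> C S i) (\<alpha> S j) = (if i = j then 1 else 0)))"

end

theory Submission
  imports Defs
begin

text \<open>For a Coxeter element \<open>C\<close> the map \<open>z \<mapsto> z - C z\<close> is invertible, so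
  \<open>E x y = (1 - C)\<^sup>-\<^sup>1 x \<bullet> y\<close> is a bilinear form depending on \<open>C\<close> alone. Up to the order of its
  arguments it is the Euler form of the oriented Dynkin diagram: for every compatible simple root
  system, the matrix of \<open>E\<close> in the simple roots has 1 on the diagonal, \<open>-1\<close> at \<open>(j, i)\<close> for each
  arrow \<open>i \<rightarrow> j\<close>, and 0 elsewhere. Since the diagram is a forest, the \<open>\<beta>\<^sub>i\<close> are dual to the
  \<open>\<alpha>\<^sub>j\<close> under \<open>E\<close>, so \<open>E\<close> restricts on the root lattice to the form in question.\<close>

section \<open>Displacement of a vector under a product of reflections\<close>

lemma linear_refl_at: "linear (refl_at a)"
  unfolding refl_at_def
  by (intro linearI) (auto simp: inner_add_left add_divide_distrib algebra_simps scaleR_add_left)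

lemma refl_prod_Nil: "refl_prod [] = id"
  by (simp add: refl_prod_def)

lemma refl_prod_Cons: "refl_prod (a # as) = refl_at a \<circ> refl_prod as"
  by (simp add: refl_prod_def fun_eq_iff)

lemma linear_refl_prod: "linear (refl_prod as)"
proof (induction as)
  case Nil
  then show ?case by (simp only: refl_prod_Nil linear_id)
next
  case (Cons a as)
  then show ?case
    by (simp only: refl_prod_Cons linear_compose[OF Cons.IH linear_refl_at])
qed

lemma refl_at_norm2: "a \<bullet> a = 2 \<Longrightarrow> refl_at a x = x - (x \<bullet> a) *\<^sub>R a"
  by (simp add: refl_at_def)

text \<open>The coefficient \<open>c k\<close> is the inner product of \<open>as ! k\<close> with
  the image of \<open>z\<close> under the reflections after position \<open>k\<close>. That image is
  \<open>z\<close> minus the terms \<open>c m *\<^sub>R as ! m\<close> with \<open>m > k\<close>;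
  pairing it with \<open>as ! k\<close> gives the second equation.\<close>

lemma refl_prod_displacement:
  fixes as :: "'a::euclidean_space list"
  assumes "\<And>a. a \<in> set as \<Longrightarrow> a \<bullet> a = 2"
  shows "\<exists>c. z - refl_prod as z = (\<Sum>k<length as. c k *\<^sub>R as ! k) \<and>
    (\<forall>k<length as. z \<bullet> (as ! k) = c k + (\<Sum>m=Suc k..<length as. c m * ((as ! m) \<bullet> (as ! k))))"
  using assms
proof (induction as)
  case Nil
  then show ?case by (simp add: refl_prod_Nil)
next
  case (Cons a as)
  then obtain c where
    c1: "z - refl_prod as z = (\<Sum>k<length as. c k *\<^sub>R as ! k)" and
    c2: "\<And>k. k < length as \<Longrightarrow>
      z \<bullet> (as ! k) = c k + (\<Sum>m=Suc k..<length as. c m * ((as ! m) \<bullet> (as ! k)))"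
    by auto
  \<comment> \<open>The new head reflection acts last, on \<open>refl_prod as z\<close>, so it adds
    one coefficient in front and shifts the old ones by one.\<close>
  define d where "d = (\<lambda>k. case k of 0 \<Rightarrow> refl_prod as z \<bullet> a | Suc k \<Rightarrow> c k)"
  have shift: "(\<Sum>m=Suc (Suc k)..<Suc (length as). d m * (((a # as) ! m) \<bullet> b)) =
      (\<Sum>m=Suc k..<length as. c m * ((as ! m) \<bullet> b))" for k b
    by (subst sum.shift_bounds_Suc_ivl) (simp add: d_def)
  have shift0: "(\<Sum>m=Suc 0..<Suc (length as). d m * (((a # as) ! m) \<bullet> b)) =
      (\<Sum>m<length as. c m * ((as ! m) \<bullet> b))" for b
    by (subst sum.shift_bounds_Suc_ivl) (simp add: d_def atLeast0LessThan)
  have "refl_prod (a # as) z = refl_prod as z - (refl_prod as z \<bullet> a) *\<^sub>R a"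
    using Cons.prems[of a] by (simp add: refl_prod_Cons refl_at_norm2)
  then have "z - refl_prod (a # as) z =
      (\<Sum>k<length as. c k *\<^sub>R as ! k) + (refl_prod as z \<bullet> a) *\<^sub>R a"
    by (simp flip: c1)
  also have "\<dots> = (\<Sum>k<length (a # as). d k *\<^sub>R (a # as) ! k)"
    by (simp add: sum.lessThan_Suc_shift d_def del: sum.lessThan_Suc)
  finally have 1: "z - refl_prod (a # as) z = (\<Sum>k<length (a # as). d k *\<^sub>R (a # as) ! k)" .
  have 2: "z \<bullet> ((a # as) ! k) = d k +
      (\<Sum>m=Suc k..<length (a # as). d m * (((a # as) ! m) \<bullet> ((a # as) ! k)))"
    if "k < length (a # as)" for k
  proof (cases k)
    case 0
    have "z = refl_prod as z + (\<Sum>k<length as. c k *\<^sub>R as ! k)"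
      using c1 by (simp add: algebra_simps)
    then have "z \<bullet> a = refl_prod as z \<bullet> a + (\<Sum>k<length as. c k *\<^sub>R as ! k) \<bullet> a"
      by (metis inner_add_left)
    then show ?thesis
      using 0 shift0[of a] by (simp add: d_def inner_sum_left)
  next
    case (Suc j)
    then show ?thesis using c2[of j] that shift[where k = j and b = "as ! j"] by (simp add: d_def)
  qed
  from 1 2 show ?case by blast
qed

lemma sum_nth_independent:
  fixes as :: "'a::euclidean_space list"
  assumes ind: "independent (set as)" and dist: "distinct as"
    and eq: "(\<Sum>k<length as. c k *\<^sub>R as ! k) = (\<Sum>k<length as. d k *\<^sub>R as ! k)"
    and k: "k < length as"
  shows "c k = d k"
proof -
  define g where "g = the_inv_into {..<length as} ((!) as)"
  have bij: "bij_betw ((!) as) {..<length as} (set as)"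
    using dist by (rule bij_betw_nth) auto
  have g: "g (as ! m) = m" if "m < length as" for m
    unfolding g_def using bij that by (auto simp: bij_betw_def the_inv_into_f_f)
  have "(\<Sum>v\<in>set as. (c (g v) - d (g v)) *\<^sub>R v) = (\<Sum>k<length as. (c k - d k) *\<^sub>R as ! k)"
    by (subst sum.reindex_bij_betw[OF bij, symmetric]) (simp add: g)
  also have "\<dots> = 0"
    using eq by (simp add: scaleR_left_diff_distrib sum_subtractf)
  finally have "c (g (as ! k)) - d (g (as ! k)) = 0"
    using independentD[OF ind finite_set subset_refl] k by (metis nth_mem)
  then show ?thesis using g k by simp
qed

section \<open>The pairing attached to a Coxeter element and its triangular matrix\<close>

definition coxeter_pairing :: "('a::euclidean_space \<Rightarrow> 'a) \<Rightarrow> 'a \<Rightarrow> 'a \<Rightarrow> real" where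
  "coxeter_pairing C x y = inv (\<lambda>z. z - C z) x \<bullet> y"

context
  fixes as :: "'a::euclidean_space list"
  assumes norm2: "\<And>a. a \<in> set as \<Longrightarrow> a \<bullet> a = 2"
    and dist: "distinct as" and ind: "independent (set as)" and span: "span (set as) = UNIV"
begin

text \<open>If \<open>z\<close> is fixed, independence forces all displacement coefficients to
  vanish. Then \<open>z\<close> is orthogonal to every listed root, hence to their span, which is
  the whole space.\<close>

lemma bij_displacement: "bij (\<lambda>z. z - refl_prod as z)"
proof -
  have lin: "linear (\<lambda>z. z - refl_prod as z)"
    using linear_compose_sub[OF linear_ident linear_refl_prod] .
  have "z = 0" if z: "z - refl_prod as z = 0" for z
  proof -
    obtain c where
      c1: "z - refl_prod as z = (\<Sum>k<length as. c k *\<^sub>R as ! k)" and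
      c2: "\<And>k. k < length as \<Longrightarrow>
        z \<bullet> (as ! k) = c k + (\<Sum>m=Suc k..<length as. c m * ((as ! m) \<bullet> (as ! k)))"
      using refl_prod_displacement[of as z] norm2 by auto
    have "c k = 0" if "k < length as" for k
      using sum_nth_independent[OF ind dist _ that, of c "\<lambda>_. 0"] c1 z by simp
    then have "z \<bullet> (as ! k) = 0" if "k < length as" for k
      using c2[OF that] that by simp
    then have "orthogonal z a" if "a \<in> set as" for a
      using that by (auto simp: in_set_conv_nth orthogonal_def)
    then have "orthogonal z z"
      using orthogonal_to_span[of z "set as" z] span by auto
    then show ?thesis by (simp add: orthogonal_def)
  qed
  then have "inj (\<lambda>z. z - refl_prod as z)"
    using linear_injective_0[OF lin] by blast
  then show ?thesis
    using linear_injective_imp_surjective[OF lin] by (auto simp: bij_def)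
qed

lemma linear_inv_displacement: "linear (inv (\<lambda>z. z - refl_prod as z))"
proof -
  have "linear (\<lambda>z. z - refl_prod as z)"
    using linear_compose_sub[OF linear_ident linear_refl_prod] .
  then show ?thesis
    using bij_displacement by (metis bij_def inj_linear_imp_inv_linear)
qed

text \<open>The preimage \<open>z\<close> of \<open>as ! l\<close> has displacement
  \<open>as ! l\<close>, so by independence its only nonzero coefficient is a 1 at position
  \<open>l\<close>. The triangular equations of \<open>refl_prod_displacement\<close> then read off
  \<open>z \<bullet> as ! k\<close>.\<close>

lemma coxeter_pairing_triangular:
  assumes k: "k < length as" and l: "l < length as"
  shows "coxeter_pairing (refl_prod as) (as ! l) (as ! k) =
    (if l = k then 1 else if k < l then (as ! l) \<bullet> (as ! k) else 0)"
proof -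
  define z where "z = inv (\<lambda>z. z - refl_prod as z) (as ! l)"
  have z: "z - refl_prod as z = as ! l"
    unfolding z_def using bij_displacement by (metis bij_inv_eq_iff)
  obtain c where
    c1: "z - refl_prod as z = (\<Sum>k<length as. c k *\<^sub>R as ! k)" and
    c2: "\<And>k. k < length as \<Longrightarrow>
      z \<bullet> (as ! k) = c k + (\<Sum>m=Suc k..<length as. c m * ((as ! m) \<bullet> (as ! k)))"
    using refl_prod_displacement[of as z] norm2 by auto
  have "as ! l = (\<Sum>m<length as. (if m = l then 1 else 0) *\<^sub>R as ! m)"
    using l by (simp add: if_distrib[of "\<lambda>x. x *\<^sub>R _"] sum.delta cong: if_cong)
  then have c: "c m = (if m = l then 1 else 0)" if "m < length as" for m
    using sum_nth_independent[OF ind dist _ that, of c "\<lambda>m. if m = l then 1 else 0"] c1 z by simp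
  have "(\<Sum>m=Suc k..<length as. c m * ((as ! m) \<bullet> (as ! k))) =
      (\<Sum>m=Suc k..<length as. if m = l then (as ! m) \<bullet> (as ! k) else 0)"
    by (intro sum.cong) (auto simp: c)
  also have "\<dots> = (if k < l then (as ! l) \<bullet> (as ! k) else 0)"
    using l by (simp add: sum.delta Suc_le_eq)
  finally show ?thesis
    using c2[OF k] c[OF k] by (auto simp: coxeter_pairing_def z_def[symmetric])
qed

end

section \<open>Inner products of distinct simple roots\<close>

lemma simple_roots_inner:
  fixes R :: "'a::euclidean_space set"
  assumes R: "simply_laced_root_system R" and S: "simple_roots R S"
    and a: "a \<in> S" and b: "b \<in> S" and ab: "a \<noteq> b"
  shows "a \<bullet> b = 0 \<or> a \<bullet> b = -1"
proof -
  have aR: "a \<in> R" and bR: "b \<in> R" and ind: "independent S"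
    using S a b by (auto simp: simple_roots_def)
  then have na: "a \<bullet> a = 2" and nb: "b \<bullet> b = 2"
    using R by (auto simp: simply_laced_root_system_def)
  have "2 * (a \<bullet> b) / (b \<bullet> b) \<in> \<int>"
    using R aR bR by (auto simp: simply_laced_root_system_def root_system_def)
  then obtain n :: int where n: "a \<bullet> b = of_int n"
    using nb by (auto elim: Ints_cases)
  have finS: "finite S" using ind by (rule independent_imp_finite)
  \<comment> \<open>Positivity at \<open>a + b\<close> and \<open>a - b\<close> confines the integer
    \<open>a \<bullet> b\<close> to -1, 0 and 1.\<close>
  have "(a + b) \<noteq> 0"
  proof
    assume "a + b = 0"
    then have "a = - b" by (simp add: eq_neg_iff_add_eq_0)
    moreover have "- b \<in> span (S - {a})"
      using b ab by (intro span_neg span_base) auto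
    ultimately show False using ind a by (auto simp: dependent_def)
  qed
  then have "0 < (a + b) \<bullet> (a + b)" by (simp add: inner_gt_zero_iff)
  then have "-2 < a \<bullet> b" by (simp add: inner_add inner_commute na nb)
  have "0 < (a - b) \<bullet> (a - b)" using ab by (simp add: inner_gt_zero_iff)
  then have "a \<bullet> b < 2" by (simp add: inner_diff inner_commute na nb)
  \<comment> \<open>The value 1 would make \<open>b - a\<close> a root whose simple-root
    coefficients have both signs.\<close>
  have "a \<bullet> b \<noteq> 1"
  proof
    assume 1: "a \<bullet> b = 1"
    have "refl_at a b \<in> R"
      using R aR bR by (auto simp: simply_laced_root_system_def root_system_def)
    then have "b - a \<in> R"
      using 1 by (simp add: refl_at_norm2 na inner_commute)
    then obtain c :: "'a \<Rightarrow> nat" where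
      "b - a = (\<Sum>v\<in>S. of_nat (c v) *\<^sub>R v) \<or> b - a = - (\<Sum>v\<in>S. of_nat (c v) *\<^sub>R v)"
      using S unfolding simple_roots_def by blast
    \<comment> \<open>The sign \<open>s\<close> treats positive and negative roots at once.\<close>
    then obtain s :: real where s: "s = 1 \<or> s = -1"
      and e: "b - a = s *\<^sub>R (\<Sum>v\<in>S. of_nat (c v) *\<^sub>R v)"
      by (metis scaleR_one scaleR_minus_left)
    have "(\<Sum>v\<in>S. (s * of_nat (c v) - (if v = b then 1 else 0) + (if v = a then 1 else 0)) *\<^sub>R v)
        = s *\<^sub>R (\<Sum>v\<in>S. of_nat (c v) *\<^sub>R v) - (\<Sum>v\<in>S. (if v = b then 1 else 0) *\<^sub>R v)
          + (\<Sum>v\<in>S. (if v = a then 1 else 0) *\<^sub>R v)"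
      by (simp add: algebra_simps sum.distrib sum_subtractf scaleR_sum_right)
    also have "(\<Sum>v\<in>S. (if v = b then 1 else 0) *\<^sub>R v) = b"
      using b finS by (simp add: if_distrib[of "\<lambda>x. x *\<^sub>R _"] sum.delta cong: if_cong)
    also have "(\<Sum>v\<in>S. (if v = a then 1 else 0) *\<^sub>R v) = a"
      using a finS by (simp add: if_distrib[of "\<lambda>x. x *\<^sub>R _"] sum.delta cong: if_cong)
    finally have 0: "(\<Sum>v\<in>S. (s * of_nat (c v) - (if v = b then 1 else 0)
        + (if v = a then 1 else 0)) *\<^sub>R v) = 0"
      by (simp flip: e)
    have "s * of_nat (c v) - (if v = b then 1 else 0) + (if v = a then 1 else 0) = 0"
      if "v \<in> S" for v
      using independentD[OF ind finS subset_refl 0 that] .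
    from this[OF a] this[OF b] have "s * of_nat (c a) = -1" "s * of_nat (c b) = 1"
      using ab by auto
    then show False using s by auto
  qed
  then have "n \<noteq> 1" "-2 < n" "n < 2"
    using n \<open>-2 < a \<bullet> b\<close> \<open>a \<bullet> b < 2\<close> by auto
  then have "n = 0 \<or> n = -1" by auto
  then show ?thesis using n by auto
qed

section \<open>The root lattice and bilinear forms on it\<close>

lemma root_lattice_add:
  assumes "x \<in> root_lattice R" "y \<in> root_lattice R"
  shows "x + y \<in> root_lattice R"
proof -
  obtain c d :: "'a \<Rightarrow> int" where "x = (\<Sum>a\<in>R. of_int (c a) *\<^sub>R a)" "y = (\<Sum>a\<in>R. of_int (d a) *\<^sub>R a)"
    using assms by (auto simp: root_lattice_def)
  then have "x + y = (\<Sum>a\<in>R. of_int (c a + d a) *\<^sub>R a)"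
    by (simp add: scaleR_left_distrib sum.distrib)
  then show ?thesis
    unfolding root_lattice_def by (intro CollectI exI[of _ "\<lambda>a. c a + d a"]) auto
qed

lemma root_lattice_uminus:
  assumes "x \<in> root_lattice R"
  shows "- x \<in> root_lattice R"
proof -
  obtain c :: "'a \<Rightarrow> int" where "x = (\<Sum>a\<in>R. of_int (c a) *\<^sub>R a)"
    using assms by (auto simp: root_lattice_def)
  then have "- x = (\<Sum>a\<in>R. of_int (- c a) *\<^sub>R a)" by (simp add: sum_negf)
  then show ?thesis
    unfolding root_lattice_def by (intro CollectI exI[of _ "\<lambda>a. - c a"]) auto
qed

lemma root_lattice_zero: "0 \<in> root_lattice R"
  unfolding root_lattice_def by (intro CollectI exI[of _ "\<lambda>_. 0"]) auto

lemma root_in_root_lattice: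
  assumes "finite R" "a \<in> R"
  shows "a \<in> root_lattice R"
proof -
  have "a = (\<Sum>b\<in>R. of_int (if b = a then 1 else 0) *\<^sub>R b)"
    using assms
    by (simp add: if_distrib[of of_int] if_distrib[of "\<lambda>x. x *\<^sub>R _"] sum.delta cong: if_cong)
  then show ?thesis
    unfolding root_lattice_def by (intro CollectI exI[of _ "\<lambda>b. if b = a then 1 else 0"]) auto
qed

lemma int_sum_in_additive_subgroup:
  fixes H :: "'a::real_vector set"
  assumes zero: "0 \<in> H" and add: "\<And>x y. x \<in> H \<Longrightarrow> y \<in> H \<Longrightarrow> x + y \<in> H"
    and minus: "\<And>x. x \<in> H \<Longrightarrow> - x \<in> H" and A: "A \<subseteq> H"
  shows "(\<Sum>a\<in>A. of_int (c a) *\<^sub>R a) \<in> H"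
proof -
  have "of_int n *\<^sub>R a \<in> H" if a: "a \<in> H" for n a
  proof -
    have nat: "of_nat m *\<^sub>R a \<in> H" for m
      by (induction m) (auto simp: zero add a scaleR_left_distrib)
    show ?thesis
    proof (cases n)
      case (nonneg m)
      then show ?thesis using nat[of m] by simp
    next
      case (neg m)
      then show ?thesis
        using minus[OF nat[of "Suc m"]] by (simp only: of_int_minus of_int_of_nat_eq scaleR_minus_left)
    qed
  qed
  then show ?thesis
    using A by (induction A rule: infinite_finite_induct) (auto simp: zero add)
qed

text \<open>The lattice elements satisfying \<open>P\<close> form an additive subgroup. It contains
  \<open>S\<close>, hence every root, since roots are integer combinations of \<open>S\<close>,
  hence the whole lattice.\<close>

lemma root_lattice_induct [consumes 2, case_names simple zero add minus]:
  fixes R :: "'a::euclidean_space set"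
  assumes S: "simple_roots R S" and x: "x \<in> root_lattice R"
    and simple: "\<And>a. a \<in> S \<Longrightarrow> P a" and zero: "P 0"
    and add: "\<And>x y. x \<in> root_lattice R \<Longrightarrow> y \<in> root_lattice R \<Longrightarrow> P x \<Longrightarrow> P y \<Longrightarrow> P (x + y)"
    and minus: "\<And>x. x \<in> root_lattice R \<Longrightarrow> P x \<Longrightarrow> P (- x)"
    and fin: "finite R"
  shows "P x"
proof -
  let ?H = "{x \<in> root_lattice R. P x}"
  note H = int_sum_in_additive_subgroup[of ?H]
  have "S \<subseteq> ?H"
    using S simple root_in_root_lattice[OF fin] by (auto simp: simple_roots_def)
  then have "(\<Sum>a\<in>S. of_int (c a) *\<^sub>R a) \<in> ?H" for c
    by (intro H) (auto simp: zero add minus root_lattice_zero root_lattice_add root_lattice_uminus)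
  from this[of "\<lambda>a. int (c a)" for c] have nat: "(\<Sum>a\<in>S. of_nat (c a) *\<^sub>R a) \<in> ?H" for c
    by simp
  have "R \<subseteq> ?H"
  proof
    fix b assume "b \<in> R"
    then obtain c :: "'a \<Rightarrow> nat" where
      "b = (\<Sum>a\<in>S. of_nat (c a) *\<^sub>R a) \<or> b = - (\<Sum>a\<in>S. of_nat (c a) *\<^sub>R a)"
      using S unfolding simple_roots_def by blast
    then show "b \<in> ?H"
      using nat[of c] by (auto simp: minus root_lattice_uminus)
  qed
  then have "(\<Sum>a\<in>R. of_int (c a) *\<^sub>R a) \<in> ?H" for c
    by (intro H) (auto simp: zero add minus root_lattice_zero root_lattice_add root_lattice_uminus)
  then show ?thesis using x by (auto simp: root_lattice_def)
qed

lemma bilinear_form_on_zero: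
  assumes "bilinear_form_on (root_lattice R) f" "y \<in> root_lattice R"
  shows "f 0 y = 0" "f y 0 = 0"
  using assms root_lattice_zero[of R] unfolding bilinear_form_on_def
  by (metis add_cancel_right_right add.right_neutral)+

lemma bilinear_form_on_minus:
  assumes f: "bilinear_form_on (root_lattice R) f" and x: "x \<in> root_lattice R"
    and y: "y \<in> root_lattice R"
  shows "f (- x) y = - f x y" "f y (- x) = - f y x"
proof -
  have "f (x + - x) y = f x y + f (- x) y" "f y (x + - x) = f y x + f y (- x)"
    using f x y root_lattice_uminus[OF x] unfolding bilinear_form_on_def by blast+
  then show "f (- x) y = - f x y" "f y (- x) = - f y x"
    using bilinear_form_on_zero[OF f y] by auto
qed

text \<open>Lattice induction is applied to each argument in turn: first \<open>y\<close> varies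
  against a fixed simple root, then \<open>x\<close> varies against a fixed
  \<open>y\<close>.\<close>

lemma bilinear_form_on_eqI:
  assumes S: "simple_roots R S" and fin: "finite R"
    and f: "bilinear_form_on (root_lattice R) f" and g: "bilinear_form_on (root_lattice R) g"
    and eq: "\<And>a b. a \<in> S \<Longrightarrow> b \<in> S \<Longrightarrow> f a b = g a b"
    and x: "x \<in> root_lattice R" and y: "y \<in> root_lattice R"
  shows "f x y = g x y"
proof -
  have SQ: "S \<subseteq> root_lattice R"
    using S root_in_root_lattice[OF fin] by (auto simp: simple_roots_def)
  have 1: "f a y = g a y" if a: "a \<in> S" for a
  proof -
    have aQ: "a \<in> root_lattice R" using a SQ by auto
    show ?thesis using S y
    proof (induction rule: root_lattice_induct)
      case (add x y)
      then show ?case using f g aQ by (simp add: bilinear_form_on_def)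
    qed (use a eq fin f g aQ in \<open>simp_all add: bilinear_form_on_zero bilinear_form_on_minus\<close>)
  qed
  show ?thesis using S x
  proof (induction rule: root_lattice_induct)
    case (add x y')
    then show ?case using f g y by (simp add: bilinear_form_on_def)
  qed (use 1 fin f g y in \<open>simp_all add: bilinear_form_on_zero bilinear_form_on_minus\<close>)
qed

section \<open>Arrows of the orientation read off from the pairing\<close>

locale compatible_simple_roots =
  fixes R :: "'a::euclidean_space set" and I :: "'i set" and \<alpha> :: "'a set \<Rightarrow> 'i \<Rightarrow> 'a"
    and C :: "'a \<Rightarrow> 'a" and S :: "'a set"
  assumes R: "simply_laced_root_system R"
    and compat: "compatible R I \<alpha> C S"
    and bij: "bij_betw (\<alpha> S) I S"
begin

abbreviation "E \<equiv> coxeter_pairing C"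
abbreviation "arrow \<equiv> orientation_arrow I \<alpha> C S"
abbreviation "le \<equiv> orientation_le I \<alpha> C S"
abbreviation "Q \<equiv> root_lattice R"

lemma S: "simple_roots R S"
  using compat by (simp add: compatible_def)

lemma finR: "finite R"
  using R by (simp add: simply_laced_root_system_def root_system_def)

lemma indS: "independent S"
  using S by (simp add: simple_roots_def)

lemma finI: "finite I"
  using bij independent_imp_finite[OF indS] by (simp add: bij_betw_finite)

lemma root_in_S: "i \<in> I \<Longrightarrow> \<alpha> S i \<in> S"
  using bij by (auto simp: bij_betw_def)

lemma norm2_S: "a \<in> S \<Longrightarrow> a \<bullet> a = 2"
  using R S by (auto simp: simply_laced_root_system_def simple_roots_def)

lemma root_eq_iff: "i \<in> I \<Longrightarrow> j \<in> I \<Longrightarrow> \<alpha> S i = \<alpha> S j \<longleftrightarrow> i = j"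
  using bij by (auto simp: bij_betw_def inj_on_def)

lemma spanS: "span S = UNIV"
proof -
  have "R \<subseteq> span S"
  proof
    fix b assume "b \<in> R"
    then obtain c :: "'a \<Rightarrow> nat" where
      "b = (\<Sum>a\<in>S. of_nat (c a) *\<^sub>R a) \<or> b = - (\<Sum>a\<in>S. of_nat (c a) *\<^sub>R a)"
      using S unfolding simple_roots_def by blast
    moreover have "(\<Sum>a\<in>S. of_nat (c a) *\<^sub>R a) \<in> span S"
      by (intro span_sum span_scale span_base)
    ultimately show "b \<in> span S" by (auto intro: span_neg)
  qed
  moreover have "span R = UNIV"
    using R by (simp add: simply_laced_root_system_def root_system_def)
  ultimately show ?thesis by (metis span_mono span_span top.extremum_uniqueI)
qed

lemma word_set:
  assumes "coxeter_word I \<alpha> C S is"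
  shows "set (map (\<alpha> S) is) = S" "distinct (map (\<alpha> S) is)"
  using assms bij by (auto simp: coxeter_word_def bij_betw_def distinct_map)

lemma linear_pairing_left: "linear (\<lambda>x. E x y)"
proof -
  obtain "is" where w: "coxeter_word I \<alpha> C S is"
    using compat by (auto simp: compatible_def)
  have "linear (inv (\<lambda>z. z - refl_prod (map (\<alpha> S) is) z))"
    by (rule linear_inv_displacement)
      (use w word_set[OF w] indS spanS norm2_S in \<open>auto simp: coxeter_word_def\<close>)
  then have "linear (inv (\<lambda>z. z - C z))"
    using w by (simp add: coxeter_word_def)
  then show ?thesis
    unfolding coxeter_pairing_def
    by (intro linearI) (simp_all add: linear_add linear_scale inner_add_left)
qed

lemma linear_pairing_right: "linear (E x)"
  unfolding coxeter_pairing_def by (intro linearI) (simp_all add: inner_add_right)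

lemma word_pairing:
  assumes w: "coxeter_word I \<alpha> C S is" and k: "k < length is" and l: "l < length is"
  shows "E (\<alpha> S (is ! l)) (\<alpha> S (is ! k)) =
    (if l = k then 1 else if k < l then \<alpha> S (is ! l) \<bullet> \<alpha> S (is ! k) else 0)"
proof -
  have "coxeter_pairing (refl_prod (map (\<alpha> S) is)) (map (\<alpha> S) is ! l) (map (\<alpha> S) is ! k) =
    (if l = k then 1 else if k < l then map (\<alpha> S) is ! l \<bullet> map (\<alpha> S) is ! k else 0)"
    by (rule coxeter_pairing_triangular)
      (use w word_set[OF w] indS spanS norm2_S k l in \<open>auto simp: coxeter_word_def\<close>)
  then show ?thesis using w k l by (simp add: coxeter_word_def)
qed

lemma roots_in_word:
  assumes "i \<in> I" "j \<in> I"
  obtains "is" k l where "coxeter_word I \<alpha> C S is" "k < length is" "l < length is"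
    "is ! k = i" "is ! l = j" "k = l \<longleftrightarrow> i = j"
proof -
  obtain "is" where w: "coxeter_word I \<alpha> C S is"
    using compat by (auto simp: compatible_def)
  then have "i \<in> set is" "j \<in> set is" and "distinct is"
    using assms by (auto simp: coxeter_word_def)
  then show ?thesis
    using that[OF w] by (metis in_set_conv_nth nth_eq_iff_index_eq)
qed

lemma pairing_self: "i \<in> I \<Longrightarrow> E (\<alpha> S i) (\<alpha> S i) = 1"
  using roots_in_word[of i i] word_pairing by metis

text \<open>An arrow may be witnessed by any word for \<open>C\<close>, whereas \<open>E\<close>
  involves only \<open>C\<close>. Evaluating \<open>E\<close> in a single word therefore decides the
  arrow, so the relative order of adjacent labels is the same in all words. The tail of the arrow
  stands in the second argument.\<close>

lemma arrow_iff:
  assumes ij: "i \<in> I" "j \<in> I" "i \<noteq> j"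
  shows "arrow i j \<longleftrightarrow> E (\<alpha> S j) (\<alpha> S i) = -1"
proof
  assume "arrow i j"
  then obtain "is" k l where w: "coxeter_word I \<alpha> C S is"
    and kl: "k < l" "l < length is" "is ! k = i" "is ! l = j" and n: "dynkin_n \<alpha> S i j = 1"
    by (auto simp: orientation_arrow_def)
  then show "E (\<alpha> S j) (\<alpha> S i) = -1"
    using word_pairing[OF w, of k l] by (auto simp: dynkin_n_def inner_commute)
next
  assume E: "E (\<alpha> S j) (\<alpha> S i) = -1"
  obtain "is" k l where w: "coxeter_word I \<alpha> C S is" "k < length is" "l < length is"
    "is ! k = i" "is ! l = j" "k = l \<longleftrightarrow> i = j"
    using roots_in_word[OF ij(1,2)] .
  then have "k < l \<and> \<alpha> S j \<bullet> \<alpha> S i = -1"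
    using word_pairing[OF w(1-3)] E by (auto split: if_splits)
  then show "arrow i j"
    using ij w by (auto simp: orientation_arrow_def dynkin_n_def inner_commute)
qed

lemma pairing_roots:
  assumes ij: "i \<in> I" "j \<in> I"
  shows "E (\<alpha> S j) (\<alpha> S i) = of_bool (i = j) - of_bool (arrow i j)"
proof (cases "i = j")
  case True
  then show ?thesis using pairing_self ij by (simp add: orientation_arrow_def)
next
  case False
  obtain "is" k l where w: "coxeter_word I \<alpha> C S is" "k < length is" "l < length is"
    "is ! k = i" "is ! l = j" "k = l \<longleftrightarrow> i = j"
    using roots_in_word[OF ij] .
  have "\<alpha> S j \<bullet> \<alpha> S i = 0 \<or> \<alpha> S j \<bullet> \<alpha> S i = -1"
    using simple_roots_inner[OF R S] root_in_S root_eq_iff ij False by metis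
  then have "E (\<alpha> S j) (\<alpha> S i) = 0 \<or> E (\<alpha> S j) (\<alpha> S i) = -1"
    using word_pairing[OF w(1-3)] w False by (auto split: if_splits)
  then show ?thesis using arrow_iff[OF ij False] False by auto
qed

text \<open>Off the diagonal, one order of the arguments contributes the whole inner product and the
  other 0; on the diagonal, 1 + 1 is the squared length. Thus the symmetrization of \<open>E\<close>
  is positive definite, which drives the forest argument.\<close>

lemma inner_roots:
  assumes ij: "i \<in> I" "j \<in> I"
  shows "\<alpha> S i \<bullet> \<alpha> S j = E (\<alpha> S i) (\<alpha> S j) + E (\<alpha> S j) (\<alpha> S i)"
proof -
  obtain "is" k l where w: "coxeter_word I \<alpha> C S is" "k < length is" "l < length is"
    "is ! k = i" "is ! l = j" "k = l \<longleftrightarrow> i = j"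
    using roots_in_word[OF ij] .
  show ?thesis
    using word_pairing[OF w(1-3)] word_pairing[OF w(1,3,2)] w norm2_S[OF root_in_S[OF ij(1)]]
    by (auto simp: inner_commute)
qed

section \<open>Acyclicity, the forest property and duality of the two bases\<close>

lemma arrow_rank: "\<exists>p :: 'i \<Rightarrow> nat. \<forall>i j. arrow i j \<longrightarrow> p i < p j"
proof -
  obtain "is" where w: "coxeter_word I \<alpha> C S is"
    using compat by (auto simp: compatible_def)
  \<comment> \<open>The rank is the position in one fixed word.\<close>
  define p where "p = the_inv_into {..<length is} ((!) is)"
  have d: "distinct is" and I: "set is = I" using w by (auto simp: coxeter_word_def)
  have p: "p (is ! m) = m" if "m < length is" for m
    unfolding p_def using d that
    by (intro the_inv_into_f_f) (auto intro: inj_on_nth)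
  have "p i < p j" if a: "arrow i j" for i j
  proof -
    have ij: "i \<in> I" "j \<in> I" "i \<noteq> j" using a by (auto simp: orientation_arrow_def)
    then obtain k l where kl: "k < length is" "l < length is" "is ! k = i" "is ! l = j"
      using I by (metis in_set_conv_nth)
    \<comment> \<open>The arrow may come from a different word; its value under \<open>E\<close>
      transfers it to the fixed one.\<close>
    have "E (\<alpha> S j) (\<alpha> S i) = -1" using arrow_iff[OF ij] a by simp
    then have "k < l"
      using word_pairing[OF w kl(1,2)] kl by (auto split: if_splits)
    then show ?thesis using p[OF kl(1)] p[OF kl(2)] kl by simp
  qed
  then show ?thesis by blast
qed

text \<open>Only an equivalence is available, because the reflexive closure also relates labels
  outside \<open>I\<close> to themselves.\<close>

lemma le_in_I: "le i j \<Longrightarrow> i \<in> I \<longleftrightarrow> j \<in> I"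
  unfolding orientation_le_def
  by (induction rule: rtranclp_induct) (auto simp: orientation_arrow_def)

lemma le_refl: "le i i"
  by (simp add: orientation_le_def)

lemma le_trans: "le i j \<Longrightarrow> le j k \<Longrightarrow> le i k"
  by (auto simp: orientation_le_def)

lemma arrow_le: "arrow i j \<Longrightarrow> le i j"
  by (auto simp: orientation_le_def)

lemma le_cases: "le i j \<Longrightarrow> i = j \<or> (\<exists>m. arrow i m \<and> le m j)"
  unfolding orientation_le_def by (metis converse_rtranclpE)

lemma le_rank:
  assumes p: "\<And>i j. arrow i j \<Longrightarrow> p i < (p j :: nat)" and "le i j"
  shows "i = j \<or> p i < p j"
  using assms(2) unfolding orientation_le_def
proof (induction rule: rtranclp_induct)
  case (step y z)
  then show ?case using p[of y z] by auto
qed simp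

lemma arrow_not_le:
  assumes "arrow i j"
  shows "\<not> le j i"
proof
  assume j: "le j i"
  obtain p :: "'i \<Rightarrow> nat" where p: "\<And>i j. arrow i j \<Longrightarrow> p i < p j"
    using arrow_rank by blast
  from p[OF assms] show False
    using le_rank[of p, OF p j] by auto
qed

text \<open>The Dynkin diagram is a forest: for two successors \<open>j \<noteq> j'\<close>, the sum \<open>v\<close> of the simple roots
  over the interval from \<open>k\<close> to \<open>i\<close> would have \<open>v \<bullet> v = 2 E v v \<le> 0\<close>, because the interval
  contains at least as many arrows as vertices.\<close>

lemma successor_unique:
  assumes kj: "arrow k j" and kj': "arrow k j'" and ji: "le j i" and ji': "le j' i"
  shows "j = j'"
proof (rule ccontr)
  assume ne: "j \<noteq> j'"
  have I: "k \<in> I" "j \<in> I" "j' \<in> I" using kj kj' by (auto simp: orientation_arrow_def)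
  then have iI: "i \<in> I" using le_in_I[OF ji] by simp
  define T where "T = {m. le k m \<and> le m i}"
  have TI: "T \<subseteq> I" using I le_in_I by (auto simp: T_def)
  then have finT: "finite T" using finI finite_subset by blast
  have ki: "le k i" using arrow_le[OF kj] ji by (rule le_trans)
  have T: "k \<in> T" "i \<in> T" "j \<in> T" "j' \<in> T"
    using ki kj kj' ji ji' arrow_le le_refl by (auto simp: T_def)
  have "k \<noteq> i" using arrow_not_le[OF kj] ji by auto
  define v where "v = (\<Sum>m\<in>T. \<alpha> S m)"
  \<comment> \<open>Each vertex contributes 1 for itself and -1 for every arrow from it that ends in
    the interval.\<close>
  have out: "(\<Sum>m\<in>T. E (\<alpha> S m) (\<alpha> S n)) = 1 - real (card {m\<in>T. arrow n m})" if n: "n \<in> T" for n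
  proof -
    have "(\<Sum>m\<in>T. E (\<alpha> S m) (\<alpha> S n)) = (\<Sum>m\<in>T. of_bool (n = m) - of_bool (arrow n m))"
      using TI n by (intro sum.cong) (auto simp: pairing_roots subset_iff)
    also have "\<dots> = (\<Sum>m\<in>T. of_bool (n = m)) - (\<Sum>m\<in>T. of_bool (arrow n m))"
      by (rule sum_subtractf)
    also have "(\<Sum>m\<in>T. of_bool (n = m)) = (1::real)"
      using n finT by (simp add: of_bool_def)
    also have "(\<Sum>m\<in>T. of_bool (arrow n m)) = real (card {m\<in>T. arrow n m})"
      using finT by (simp add: of_bool_def sum.If_cases Int_def)
    finally show ?thesis .
  qed
  \<comment> \<open>The contribution is at most -1 at \<open>k\<close>, which has the two successors
    \<open>j\<close> and \<open>j'\<close>, at most 1 at \<open>i\<close>, and at most 0 elsewhere,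
    so the bounds add up to 0.\<close>
  have out1: "(\<Sum>m\<in>T. E (\<alpha> S m) (\<alpha> S n)) \<le> of_bool (n = i) - of_bool (n = k)" if n: "n \<in> T" for n
  proof -
    have fin: "finite {m\<in>T. arrow n m}" using finT by simp
    consider "n = k" | "n = i" "n \<noteq> k" | "n \<noteq> k" "n \<noteq> i" by blast
    then show ?thesis
    proof cases
      case 1
      then have "{j, j'} \<subseteq> {m\<in>T. arrow n m}" using T kj kj' by auto
      from card_mono[OF fin this] ne have "2 \<le> card {m\<in>T. arrow n m}" by simp
      then show ?thesis using out[OF n] 1 \<open>k \<noteq> i\<close> by simp
    next
      case 2
      then show ?thesis using out[OF n] by simp
    next
      case 3
      have "le k n" "le n i" using n by (auto simp: T_def)
      \<comment> \<open>The first step of a path from \<open>n\<close> to \<open>i\<close> stays in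
        the interval.\<close>
      then obtain m where m: "arrow n m" "le m i"
        using le_cases[of n i] 3 by auto
      then have "m \<in> {m\<in>T. arrow n m}"
        using le_trans[OF \<open>le k n\<close> arrow_le[OF m(1)]] by (auto simp: T_def)
      then have "card {m\<in>T. arrow n m} \<ge> 1"
        using fin by (metis One_nat_def Suc_leI card_gt_0_iff empty_iff)
      then show ?thesis using out[OF n] 3 by simp
    qed
  qed
  have "v \<bullet> v = (\<Sum>n\<in>T. \<Sum>m\<in>T. \<alpha> S m \<bullet> \<alpha> S n)"
    unfolding v_def by (simp add: inner_sum_left inner_sum_right)
  also have "\<dots> = (\<Sum>n\<in>T. \<Sum>m\<in>T. E (\<alpha> S m) (\<alpha> S n)) + (\<Sum>n\<in>T. \<Sum>m\<in>T. E (\<alpha> S n) (\<alpha> S m))"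
    using TI by (simp add: inner_roots subset_iff sum.distrib)
  also have "(\<Sum>n\<in>T. \<Sum>m\<in>T. E (\<alpha> S n) (\<alpha> S m)) = (\<Sum>n\<in>T. \<Sum>m\<in>T. E (\<alpha> S m) (\<alpha> S n))"
    by (rule sum.swap)
  finally have vv: "v \<bullet> v = 2 * (\<Sum>n\<in>T. \<Sum>m\<in>T. E (\<alpha> S m) (\<alpha> S n))" by simp
  have "(\<Sum>n\<in>T. \<Sum>m\<in>T. E (\<alpha> S m) (\<alpha> S n)) \<le> (\<Sum>n\<in>T. of_bool (n = i) - of_bool (n = k))"
    by (intro sum_mono out1)
  also have "(\<Sum>n\<in>T. of_bool (n = i) - of_bool (n = k) :: real) = 0"
    using finT T by (simp add: sum_subtractf of_bool_def)
  finally have "v \<bullet> v = 0"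
    using vv inner_ge_zero[of v] by linarith
  then have "v = 0" by simp
  have inj: "inj_on (\<alpha> S) T" using bij TI by (auto simp: bij_betw_def inj_on_def)
  \<comment> \<open>A vanishing \<open>v\<close> is a linear relation among simple roots with all
    coefficients 1, over a set containing \<open>\<alpha> S k\<close>.\<close>
  have "(\<Sum>a\<in>\<alpha> S ` T. 1 *\<^sub>R a) = 0"
    using \<open>v = 0\<close> inj by (simp add: v_def sum.reindex)
  then have "(1::real) = 0"
    using independentD[OF indS, of "\<alpha> S ` T" "\<lambda>_. 1" "\<alpha> S k"] finT TI T root_in_S by auto
  then show False by simp
qed

text \<open>The pairing is 1 if \<open>le k i\<close> and 0 otherwise, minus the number of
  successors of \<open>k\<close> below \<open>i\<close>. If \<open>k\<close> lies strictly below
  \<open>i\<close> there is exactly one: the first step of a path gives it and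
  \<open>successor_unique\<close> excludes others. If \<open>k = i\<close> or \<open>k\<close> is
  not below \<open>i\<close>, acyclicity or transitivity leaves none.\<close>

lemma pairing_beta:
  assumes "i \<in> I" "k \<in> I"
  shows "E (beta I \<alpha> C S i) (\<alpha> S k) = of_bool (i = k)"
proof -
  define D where "D = {j\<in>I. le j i}"
  have finD: "finite D" using finI by (simp add: D_def)
  have "E (beta I \<alpha> C S i) (\<alpha> S k) = (\<Sum>j\<in>D. E (\<alpha> S j) (\<alpha> S k))"
    unfolding beta_def D_def by (simp add: linear_sum[OF linear_pairing_left])
  also have "\<dots> = (\<Sum>j\<in>D. of_bool (k = j) - of_bool (arrow k j))"
    using assms by (intro sum.cong) (auto simp: pairing_roots D_def)
  also have "\<dots> = (\<Sum>j\<in>D. of_bool (k = j)) - (\<Sum>j\<in>D. of_bool (arrow k j))"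
    by (rule sum_subtractf)
  also have "(\<Sum>j\<in>D. of_bool (k = j)) = (of_bool (le k i) :: real)"
    using finD assms by (simp add: of_bool_def D_def)
  also have "(\<Sum>j\<in>D. of_bool (arrow k j)) = real (card {j\<in>D. arrow k j})"
    using finD by (simp add: of_bool_def sum.If_cases Int_def)
  also have "card {j\<in>D. arrow k j} = of_bool (le k i \<and> k \<noteq> i)"
  proof (cases "le k i \<and> k \<noteq> i")
    case True
    then obtain j where j: "arrow k j" "le j i" using le_cases by blast
    then have "{j\<in>D. arrow k j} = {j}"
      using successor_unique[OF _ j(1) _ j(2)] by (auto simp: D_def orientation_arrow_def)
    then show ?thesis using True by simp
  next
    case False
    have "{j\<in>D. arrow k j} = {}"
      using False arrow_le le_trans arrow_not_le by (auto simp: D_def) blast+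
    then show ?thesis using False by (simp only: card.empty of_bool_eq)
  qed
  finally show ?thesis using le_refl by auto
qed

section \<open>The integral form on the root lattice and its uniqueness\<close>

lemma pairing_int:
  assumes x: "x \<in> Q" and y: "y \<in> Q"
  shows "E x y \<in> \<int>"
proof -
  have 1: "E a y \<in> \<int>" if a: "a \<in> S" for a
    using S y
  proof (induction rule: root_lattice_induct)
    case (simple b)
    then obtain i j where "i \<in> I" "j \<in> I" "a = \<alpha> S j" "b = \<alpha> S i"
      using a bij by (metis bij_betw_def imageE)
    then show ?case by (simp add: pairing_roots)
  qed (simp_all add: linear_0[OF linear_pairing_right] linear_add[OF linear_pairing_right]
      linear_neg[OF linear_pairing_right] finR)
  show ?thesis using S x
    by (induction rule: root_lattice_induct)
      (simp_all add: linear_0[OF linear_pairing_left] linear_add[OF linear_pairing_left]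
        linear_neg[OF linear_pairing_left] finR 1)
qed

text \<open>The floor only changes the type, since \<open>E\<close> is integral on the lattice. The
  value 0 off the lattice follows the convention of \<open>coxeter_form\<close>, so the two can be
  equal as functions.\<close>

definition lattice_pairing :: "'a \<Rightarrow> 'a \<Rightarrow> int" where
  "lattice_pairing x y = (if x \<in> Q \<and> y \<in> Q then \<lfloor>E x y\<rfloor> else 0)"

lemma of_int_lattice_pairing: "x \<in> Q \<Longrightarrow> y \<in> Q \<Longrightarrow> of_int (lattice_pairing x y) = E x y"
  by (simp add: lattice_pairing_def pairing_int)

lemma bilinear_lattice_pairing: "bilinear_form_on Q lattice_pairing"
proof -
  have "lattice_pairing (x + y) z = lattice_pairing x z + lattice_pairing y z"
    "lattice_pairing x (y + z) = lattice_pairing x y + lattice_pairing x z"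
    if "x \<in> Q" "y \<in> Q" "z \<in> Q" for x y z
  proof -
    have "real_of_int (lattice_pairing (x + y) z) =
        of_int (lattice_pairing x z + lattice_pairing y z)"
      using that
      by (simp add: of_int_lattice_pairing root_lattice_add linear_add[OF linear_pairing_left])
    then show "lattice_pairing (x + y) z = lattice_pairing x z + lattice_pairing y z"
      by (simp only: of_int_eq_iff)
    have "real_of_int (lattice_pairing x (y + z)) =
        of_int (lattice_pairing x y + lattice_pairing x z)"
      using that
      by (simp add: of_int_lattice_pairing root_lattice_add linear_add[OF linear_pairing_right])
    then show "lattice_pairing x (y + z) = lattice_pairing x y + lattice_pairing x z"
      by (simp only: of_int_eq_iff)
  qed
  then show ?thesis by (simp add: bilinear_form_on_def)
qed

lemma root_in_Q: "i \<in> I \<Longrightarrow> \<alpha> S i \<in> Q"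
  using root_in_root_lattice[OF finR] root_in_S S by (auto simp: simple_roots_def)

lemma sum_roots_in_Q: "A \<subseteq> I \<Longrightarrow> (\<Sum>j\<in>A. \<alpha> S j) \<in> Q"
  by (induction A rule: infinite_finite_induct)
    (auto simp: root_lattice_zero intro: root_lattice_add root_in_Q)

lemma bilinear_form_on_sum:
  assumes f: "bilinear_form_on Q f" and A: "A \<subseteq> I" and y: "y \<in> Q"
  shows "f (\<Sum>j\<in>A. \<alpha> S j) y = (\<Sum>j\<in>A. f (\<alpha> S j) y)"
  using A
proof (induction A rule: infinite_finite_induct)
  case (insert x A)
  then have "\<alpha> S x \<in> Q" "(\<Sum>j\<in>A. \<alpha> S j) \<in> Q" by (auto intro: root_in_Q sum_roots_in_Q)
  then have "f (\<alpha> S x + (\<Sum>j\<in>A. \<alpha> S j)) y = f (\<alpha> S x) y + f (\<Sum>j\<in>A. \<alpha> S j) y"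
    using f y by (auto simp: bilinear_form_on_def)
  then show ?case using insert by simp
qed (use f y in \<open>auto simp: bilinear_form_on_zero\<close>)

text \<open>Each \<open>beta\<close> is its own simple root plus simple roots of strictly smaller
  rank. Induction on the rank therefore recovers the values on pairs of simple roots, which
  determine the form.\<close>

lemma dual_form_unique:
  assumes f: "bilinear_form_on Q f" and g: "bilinear_form_on Q g"
    and eq: "\<And>i j. i \<in> I \<Longrightarrow> j \<in> I \<Longrightarrow> f (beta I \<alpha> C S i) (\<alpha> S j) = g (beta I \<alpha> C S i) (\<alpha> S j)"
    and x: "x \<in> Q" and y: "y \<in> Q"
  shows "f x y = g x y"
proof -
  obtain p :: "'i \<Rightarrow> nat" where p: "\<And>i j. arrow i j \<Longrightarrow> p i < p j"
    using arrow_rank by blast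
  have *: "f (\<alpha> S i) (\<alpha> S j) = g (\<alpha> S i) (\<alpha> S j)" if "i \<in> I" "j \<in> I" for i j
    using that(1)
  proof (induction i rule: measure_induct_rule[of p])
    case (less i)
    define D where "D = {j\<in>I. le j i}"
    have D: "D \<subseteq> I" "finite D" "i \<in> D"
      using finI less.prems le_refl by (auto simp: D_def)
    have split: "h (beta I \<alpha> C S i) (\<alpha> S j) =
        h (\<alpha> S i) (\<alpha> S j) + (\<Sum>m\<in>D - {i}. h (\<alpha> S m) (\<alpha> S j))"
      if "bilinear_form_on Q h" for h
      using bilinear_form_on_sum[OF that D(1) root_in_Q[OF \<open>j \<in> I\<close>]] D
      by (simp add: beta_def D_def[symmetric] sum.remove)
    \<comment> \<open>Every label in \<open>D\<close> other than \<open>i\<close> has smaller rank,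
      so the induction hypothesis applies termwise.\<close>
    have "(\<Sum>m\<in>D - {i}. f (\<alpha> S m) (\<alpha> S j)) = (\<Sum>m\<in>D - {i}. g (\<alpha> S m) (\<alpha> S j))"
      using less.IH le_rank[of p, OF p] by (intro sum.cong) (auto simp: D_def)
    then show ?case
      using split[OF f] split[OF g] eq[OF less.prems \<open>j \<in> I\<close>] by simp
  qed
  show ?thesis
  proof (rule bilinear_form_on_eqI[OF S finR f g _ x y])
    fix a b assume "a \<in> S" "b \<in> S"
    then obtain i j where "i \<in> I" "j \<in> I" "a = \<alpha> S i" "b = \<alpha> S j"
      using bij by (metis bij_betw_def imageE)
    then show "f a b = g a b" using * by simp
  qed
qed

lemma lattice_pairing_beta:
  assumes "i \<in> I" "j \<in> I"
  shows "lattice_pairing (beta I \<alpha> C S i) (\<alpha> S j) = (if i = j then 1 else 0)"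
proof -
  have "beta I \<alpha> C S i \<in> Q" unfolding beta_def by (intro sum_roots_in_Q) auto
  then have "real_of_int (lattice_pairing (beta I \<alpha> C S i) (\<alpha> S j)) = of_bool (i = j)"
    using assms by (simp add: of_int_lattice_pairing root_in_Q pairing_beta)
  then show ?thesis by (auto split: if_splits)
qed

lemma coxeter_form_eq: "coxeter_form R I \<alpha> C S = lattice_pairing"
  unfolding coxeter_form_def
proof (rule the_equality)
  show "bilinear_form_on Q lattice_pairing \<and>
     (\<forall>x y. x \<notin> Q \<or> y \<notin> Q \<longrightarrow> lattice_pairing x y = 0) \<and>
     (\<forall>i\<in>I. \<forall>j\<in>I. lattice_pairing (beta I \<alpha> C S i) (\<alpha> S j) = (if i = j then 1 else 0))"
    using bilinear_lattice_pairing lattice_pairing_beta by (auto simp: lattice_pairing_def)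
next
  fix f
  assume f: "bilinear_form_on Q f \<and> (\<forall>x y. x \<notin> Q \<or> y \<notin> Q \<longrightarrow> f x y = 0) \<and>
     (\<forall>i\<in>I. \<forall>j\<in>I. f (beta I \<alpha> C S i) (\<alpha> S j) = (if i = j then 1 else 0))"
  have "f x y = lattice_pairing x y" for x y
  proof (cases "x \<in> Q \<and> y \<in> Q")
    case True
    then show ?thesis
      using dual_form_unique[of f lattice_pairing x y] f bilinear_lattice_pairing
        lattice_pairing_beta by auto
  next
    case False
    then show ?thesis using f by (auto simp: lattice_pairing_def)
  qed
  then show "f = lattice_pairing" by blast
qed

text \<open>The right-hand side mentions \<open>C\<close> but not \<open>S\<close>: this is the
  independence of the simple root system.\<close>

lemma coxeter_form_pairing:
  "x \<in> Q \<Longrightarrow> y \<in> Q \<Longrightarrow> coxeter_form R I \<alpha> C S x y = \<lfloor>coxeter_pairing C x y\<rfloor>"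
  by (simp add: coxeter_form_eq lattice_pairing_def)

end

theorem theorem7p2:
  fixes R :: "'a::euclidean_space set"
    and I :: "'i set"
    and \<alpha> :: "'a set \<Rightarrow> 'i \<Rightarrow> 'a"
    and C :: "'a \<Rightarrow> 'a"
    and S S' :: "'a set"
  assumes "simply_laced_root_system R"
    and "simple_root_labelling R I \<alpha>"
    and "coxeter_element R C"
    and "compatible R I \<alpha> C S"
    and "compatible R I \<alpha> C S'"
  shows "\<forall>x\<in>root_lattice R. \<forall>y\<in>root_lattice R.
           coxeter_form R I \<alpha> C S x y = coxeter_form R I \<alpha> C S' x y"
proof -
  have "compatible_simple_roots R I \<alpha> C T" if "compatible R I \<alpha> C T" for T
    using assms(1,2) that
    by unfold_locales (auto simp: compatible_def simple_root_labelling_def)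
  then show ?thesis
    \<comment> \<open>Both forms equal the same floor of
      \<open>coxeter_pairing C x y\<close>.\<close>
    using assms(4,5) compatible_simple_roots.coxeter_form_pairing by metis
qed

end
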